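(* There is an absolute constant $C>0$ such that for every positive integer $c$ and every sufficiently large $n$, there exists a $c$-closed graph on $n$ vertices with at least $C\, c^{-3/2}\,2^{c/2}\, n^{3/2}$ maximal cliques.
   Context: All graphs are finite, simple and undirected. For a positive integer $c$, a graph is $c$-closed if every two distinct vertices with at least $c$ common neighbors are adjacent. A maximal clique is a clique not contained in any strictly larger clique.
   Formalization: The formal statement covers c ≥ 2 only; for c = 1 the claim is false, since every component of a 1-closed graph is complete, so it has at most n maximal cliques, fewer than any C√2·n^(3/2) for large n. *)

theory Defs
  imports Complex_Main "Graph_Theory.Pair_Digraph"
begin

text \<open>
  A finite simple undirected graph is a \<^term>\<open>pair_graph\<close> of the AFP entry \<open>Graph_Theory\<close>: a finite,
  loop-free digraph with symmetric arc set, so that an undirected edge is a pair of opposite arcs.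
\<close>

definition common_neighbors :: "'a pair_pre_digraph \<Rightarrow> 'a \<Rightarrow> 'a \<Rightarrow> 'a set" where
  "common_neighbors G u v = {w \<in> pverts G. (u, w) \<in> parcs G \<and> (v, w) \<in> parcs G}"

definition closed_graph :: "nat \<Rightarrow> 'a pair_pre_digraph \<Rightarrow> bool" where
  "closed_graph c G \<longleftrightarrow>
     (\<forall>u \<in> pverts G. \<forall>v \<in> pverts G.
        u \<noteq> v \<and> card (common_neighbors G u v) \<ge> c \<longrightarrow> (u, v) \<in> parcs G)"

definition clique :: "'a pair_pre_digraph \<Rightarrow> 'a set \<Rightarrow> bool" where
  "clique G K \<longleftrightarrow> K \<subseteq> pverts G \<and> (\<forall>u \<in> K. \<forall>v \<in> K. u \<noteq> v \<longrightarrow> (u, v) \<in> parcs G)"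

definition maximal_clique :: "'a pair_pre_digraph \<Rightarrow> 'a set \<Rightarrow> bool" where
  "maximal_clique G K \<longleftrightarrow> clique G K \<and> \<not> (\<exists>K'. clique G K' \<and> K \<subset> K')"

text \<open>
  The components of a 1-closed graph are complete, so a nonempty one has at most as many maximal
  cliques as vertices. A lower bound of order \<open>n powr (3/2)\<close> is therefore only possible for
  \<open>c \<ge> 2\<close>.
\<close>

lemma card_maximal_cliques_1_closed:
  assumes "pair_graph G" and closed: "closed_graph 1 G" and "pverts G \<noteq> {}"
  shows "card {K. maximal_clique G K} \<le> card (pverts G)"
proof -
  interpret pair_graph G by fact
  define N where "N v = insert v {w. (v, w) \<in> parcs G}" for v
  have sym: "(v, u) \<in> parcs G" if "(u, v) \<in> parcs G" for u v
    using that by (rule arcs_symmetric)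
  have tr: "(u, v) \<in> parcs G" if "(w, u) \<in> parcs G" "(w, v) \<in> parcs G" "u \<noteq> v" for u v w
  proof -
    have "w \<in> common_neighbors G u v"
      unfolding common_neighbors_def using that by (blast intro: sym dest: in_arcsD1)
    moreover have "finite (common_neighbors G u v)"
      using pair_finite_verts by (simp add: common_neighbors_def)
    ultimately have "card (common_neighbors G u v) \<ge> 1"
      by (auto simp: Suc_le_eq card_gt_0_iff)
    then show ?thesis
      using closed that(3) in_arcsD2[OF that(1)] in_arcsD2[OF that(2)] unfolding closed_graph_def by blast
  qed
  have N: "clique G (N v)" if "v \<in> pverts G" for v
    using that unfolding clique_def N_def by (blast intro: sym tr dest: in_arcsD2)
  have "K \<in> N ` pverts G" if K: "maximal_clique G K" for K
  proof -
    obtain x where x: "x \<in> pverts G" using \<open>pverts G \<noteq> {}\<close> by blast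
    then have "clique G {x}" by (simp add: clique_def)
    then have "K \<noteq> {}"
      using K unfolding maximal_clique_def by blast
    then obtain v where v: "v \<in> K" by blast
    then have "v \<in> pverts G" "K \<subseteq> N v"
      using K unfolding maximal_clique_def clique_def N_def by auto
    then show ?thesis
      using K N unfolding maximal_clique_def by blast
  qed
  then have "{K. maximal_clique G K} \<subseteq> N ` pverts G" by blast
  then show ?thesis
    using pair_finite_verts by (rule surj_card_le[rotated])
qed

end

theory Submission
  imports Defs "HOL-Library.Z2" "HOL-Algebra.Algebraic_Closure_Type"
begin

text \<open>
  Start from the point-line incidence graph of the affine plane over the field with \<open>q = 2 ^ r\<close>
  elements: it is bipartite, has no 4-cycle, and has \<open>q ^ 3\<close> edges on \<open>2 * q ^ 2\<close> vertices. With
  \<open>k = (c - 1) div 2\<close>, replace each vertex \<open>u\<close> by a clique \<open>u\<^sub>0, \<dots>, u\<^sub>k\<close>, and each edge \<open>u v\<close> by all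
  edges \<open>u\<^sub>i v\<^sub>j\<close> except the matching \<open>u\<^sub>i v\<^sub>i\<close> for \<open>i \<ge> 1\<close>. The ends of a removed matching edge have
  \<open>2 * k\<close> common neighbors, vertices over nonadjacent \<open>u, v\<close> have at most \<open>k + 1\<close>, and both numbers
  are less than \<open>c\<close>. Choosing for every \<open>i \<ge> 1\<close> one of \<open>u\<^sub>i, v\<^sub>i\<close>, and adding \<open>u\<^sub>0, v\<^sub>0\<close>, gives \<open>2 ^ k\<close>
  maximal cliques over each edge. Powers of 2 are dense enough for the choice of \<open>q\<close>, and isolated
  vertices fill up the graph to \<open>n\<close> vertices.
\<close>

section \<open>Finite fields\<close>

text \<open>Splitting into linear factors lists the roots with multiplicity. For
  \<open>p = 0\<close> both sides are 0, as \<open>proots 0\<close> is empty.\<close>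

lemma size_proots_alg_closed:
  fixes p :: "'a :: alg_closed_field poly"
  shows "size (proots p) = degree p"
proof (cases "p = 0")
  case False
  then obtain A where A: "size A = degree p" "p = smult (lead_coeff p) (\<Prod>x\<in>#A. [:-x, 1:])"
    using alg_closed_imp_factorization by blast
  have "proots (\<Prod>x\<in>#A. [:-x, 1:]) = A"
  proof (induction A)
    case (add x A)
    have "(\<Prod>x\<in>#A. [:-x, 1:]) \<noteq> 0"
      by (auto simp: prod_mset_zero_iff)
    then show ?case
      using add.IH by (simp add: proots_mult del: mult_pCons_left)
  qed simp
  then have "proots p = A"
    using A(2) False by (metis leading_coeff_0_iff proots_smult)
  then show ?thesis using A(1) by simp
qed simp

text \<open>The fixed points are the roots of \<open>X ^ q - X\<close>. As \<open>q\<close> vanishes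
  in the field, the derivative is -1, so all \<open>q\<close> roots are simple.\<close>

lemma card_fixed_points_Frobenius:
  fixes p r :: nat
  assumes p: "CHAR('a :: alg_closed_field) = p" "prime p" and "r > 0"
  shows "card {x :: 'a. x ^ (p ^ r) = x} = p ^ r"
proof -
  define q where "q = p ^ r"
  define f :: "'a poly" where "f = monom 1 q - [:0, 1:]"
  have "q > 1"
    unfolding q_def using prime_gt_1_nat[OF p(2)] \<open>r > 0\<close> by (rule one_less_power)
  have "degree f = q"
    unfolding f_def using \<open>q > 1\<close>
    by (subst diff_conv_add_uminus, subst degree_add_eq_left) (simp_all add: degree_monom_eq)
  then have "f \<noteq> 0" using \<open>q > 1\<close> by auto
  have roots: "poly f x = 0 \<longleftrightarrow> x ^ q = x" for x
    by (simp add: f_def poly_monom)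
  have "of_nat q = (0 :: 'a)"
    using p \<open>r > 0\<close> unfolding q_def by (simp add: of_nat_eq_0_iff_char_dvd)
  then have pderiv_f: "pderiv f = -1"
    by (simp add: f_def pderiv_diff pderiv_monom pderiv_pCons one_pCons)
  have "order x f = 1" if "x \<in> set_mset (proots f)" for x
  proof (rule antisym)
    show "order x f \<le> 1"
    proof (rule ccontr)
      assume "\<not> order x f \<le> 1"
      \<comment> \<open>A double root would also be a root of the derivative.\<close>
      then have "[:-x, 1:] ^ 2 dvd f"
        by (simp add: order_divides)
      then obtain g where g: "f = [:-x, 1:] ^ 2 * g" by (elim dvdE)
      have "poly (pderiv f) x = 0"
        unfolding g by (simp add: pderiv_mult power2_eq_square del: mult_pCons_left mult_pCons_right)
      with pderiv_f show False by simp
    qed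
    show "1 \<le> order x f"
      using that \<open>f \<noteq> 0\<close> order_root[of f x] by simp
  qed
  then have "size (proots f) = card (set_mset (proots f))"
    using \<open>f \<noteq> 0\<close> by (simp add: size_multiset_overloaded_eq)
  then show ?thesis
    using \<open>degree f = q\<close> \<open>f \<noteq> 0\<close> roots by (simp add: size_proots_alg_closed q_def)
qed

lemma CHAR_bit: "CHAR(bit) = 2"
  by (rule CHAR_eq_posI) (auto simp: numeral_2_eq_2 less_Suc_eq)

text \<open>\<open>F\<close> is the fixed field of a Frobenius power in the algebraic closure. The
  two closure properties keep \<open>m * x + b\<close> inside \<open>F\<close>; cancellation takes
  place in the ambient field.\<close>

lemma finite_field_power_2_exists:
  fixes r :: nat
  assumes "r > 0"
  obtains F :: "bit alg_closure set"
  where "card F = 2 ^ r" "\<And>x y. x \<in> F \<Longrightarrow> y \<in> F \<Longrightarrow> x + y \<in> F" "\<And>x y. x \<in> F \<Longrightarrow> y \<in> F \<Longrightarrow> x * y \<in> F"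
proof
  have char: "CHAR(bit alg_closure) = 2"
    by (simp add: CHAR_bit)
  let ?F = "{x :: bit alg_closure. x ^ (2 ^ r) = x}"
  show "card ?F = 2 ^ r"
    using card_fixed_points_Frobenius[OF char two_is_prime_nat assms] .
  show "x + y \<in> ?F" if "x \<in> ?F" "y \<in> ?F" for x y
    using that freshmans_dream'[where 'a = "bit alg_closure" and n = r and x = x and y = y]
    by (simp add: CHAR_bit two_is_prime_nat)
  show "x * y \<in> ?F" if "x \<in> ?F" "y \<in> ?F" for x y
    using that by (simp add: power_mult_distrib)
qed

section \<open>The incidence graph of an affine plane\<close>

lemma pair_graphI:
  assumes "finite (pverts G)"
    and "\<And>u v. (u, v) \<in> parcs G \<Longrightarrow> u \<in> pverts G \<and> v \<in> pverts G \<and> u \<noteq> v \<and> (v, u) \<in> parcs G"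
  shows "pair_graph G"
proof -
  have "parcs G \<subseteq> pverts G \<times> pverts G" using assms(2) by auto
  then have "finite (parcs G)"
    using assms(1) by (meson finite_SigmaI finite_subset)
  with assms show ?thesis
    by unfold_locales (fastforce simp: symmetric_def intro: symI)+
qed

definition triangle_free :: "'a pair_pre_digraph \<Rightarrow> bool" where
  "triangle_free G \<longleftrightarrow>
     (\<forall>u v w. (u, v) \<in> parcs G \<longrightarrow> (u, w) \<in> parcs G \<longrightarrow> (v, w) \<notin> parcs G)"

text \<open>The pair \<open>(m, b)\<close> encodes the line \<open>y = m * x + b\<close>; vertical lines are omitted.\<close>

definition flags :: "'a :: field set \<Rightarrow> ('a \<times> 'a + 'a \<times> 'a) rel" where
  "flags F = (\<lambda>(x, m, b). (Inl (x, m * x + b), Inr (m, b))) ` (F \<times> F \<times> F)"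

definition incidence_graph :: "'a :: field set \<Rightarrow> ('a \<times> 'a + 'a \<times> 'a) pair_pre_digraph" where
  "incidence_graph F = \<lparr>pverts = (F \<times> F) <+> (F \<times> F), parcs = flags F \<union> (flags F)\<inverse>\<rparr>"

text \<open>A flag is determined by its line \<open>(m, b)\<close> and the abscissa \<open>x\<close>
  of its point: three free parameters.\<close>

lemma card_flags:
  fixes F :: "'a :: field set"
  shows "card (flags F) = card F ^ 3"
proof -
  have "inj_on (\<lambda>(x, m, b). (Inl (x, m * x + b) :: 'a \<times> 'a + 'a \<times> 'a, Inr (m, b) :: 'a \<times> 'a + 'a \<times> 'a))
      (F \<times> F \<times> F)"
    by (auto simp: inj_on_def)
  then show ?thesis
    by (simp add: flags_def card_image card_cartesian_product power3_eq_cube)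
qed

text \<open>Flags run from \<open>Inl\<close> to \<open>Inr\<close>, so they select one arc per
  edge, as the count of cliques requires.\<close>

lemma flags_asym: "(u, v) \<in> flags F \<Longrightarrow> (v, u) \<notin> flags F"
  by (auto simp: flags_def)

lemma flags_subset_parcs: "flags F \<subseteq> parcs (incidence_graph F)"
  by (simp add: incidence_graph_def)

lemma card_pverts_incidence_graph:
  "finite F \<Longrightarrow> card (pverts (incidence_graph F)) = 2 * card F ^ 2"
  by (simp add: incidence_graph_def card_Plus card_cartesian_product power2_eq_square)

lemma pair_graph_incidence_graph:
  assumes "finite F" "\<And>x y. x \<in> F \<Longrightarrow> y \<in> F \<Longrightarrow> x + y \<in> F" "\<And>x y. x \<in> F \<Longrightarrow> y \<in> F \<Longrightarrow> x * y \<in> F"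
  shows "pair_graph (incidence_graph F)"
proof (rule pair_graphI)
  fix u v assume "(u, v) \<in> parcs (incidence_graph F)"
  then consider "(u, v) \<in> flags F" | "(v, u) \<in> flags F"
    by (auto simp: incidence_graph_def)
  moreover have "u \<in> (F \<times> F) <+> (F \<times> F) \<and> v \<in> (F \<times> F) <+> (F \<times> F) \<and> u \<noteq> v"
    if "(u, v) \<in> flags F" for u v
    using that assms(2,3) by (auto simp: flags_def)
  ultimately show "u \<in> pverts (incidence_graph F) \<and> v \<in> pverts (incidence_graph F) \<and> u \<noteq> v \<and>
      (v, u) \<in> parcs (incidence_graph F)"
    by cases (simp_all add: incidence_graph_def, blast+)
qed (simp add: incidence_graph_def \<open>finite F\<close>)

lemma triangle_free_incidence_graph: "triangle_free (incidence_graph F)"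
  by (auto simp: triangle_free_def incidence_graph_def flags_def)

text \<open>Two points share at most one line, two lines at most one point, and a point and a line
  have no common neighbor by bipartiteness.\<close>

lemma closed_incidence_graph:
  fixes F :: "'a :: field set"
  shows "closed_graph 2 (incidence_graph F)"
proof -
  \<comment> \<open>Two lines that agree at two abscissae: the slope difference times the abscissa
    difference is 0. This serves points and lines alike.\<close>
  have *: "x = x' \<or> m = m'" if "m * x + b = m' * x + b'" "m * x' + b = m' * x' + b'"
    for x x' m m' b b' :: 'a
  proof -
    have "(m - m') * (x - x') = (m * x + b - (m' * x + b')) - (m * x' + b - (m' * x' + b'))"
      by (simp add: algebra_simps)
    also have "\<dots> = 0"
      by (simp only: that diff_self)
    finally show ?thesis by auto
  qed
  have point: "\<exists>m b. w = Inr (m, b) \<and> y = m * x + b" if "(Inl (x, y), w) \<in> parcs (incidence_graph F)" for x y w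
    using that by (auto simp: incidence_graph_def flags_def)
  have line: "\<exists>x. w = Inl (x, m * x + b)" if "(Inr (m, b), w) \<in> parcs (incidence_graph F)" for m b w
    using that by (auto simp: incidence_graph_def flags_def)
  have eq: "s = t" if "u \<noteq> v" and st: "s \<in> common_neighbors (incidence_graph F) u v"
    "t \<in> common_neighbors (incidence_graph F) u v" for u v s t
  proof -
    have E: "(u, s) \<in> parcs (incidence_graph F)" "(v, s) \<in> parcs (incidence_graph F)"
      "(u, t) \<in> parcs (incidence_graph F)" "(v, t) \<in> parcs (incidence_graph F)"
      using st by (simp_all add: common_neighbors_def)
    consider x y x' y' where "u = Inl (x, y)" "v = Inl (x', y')"
      | m b m' b' where "u = Inr (m, b)" "v = Inr (m', b')"
      | x y m b where "u = Inl (x, y)" "v = Inr (m, b)"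
      | x y m b where "u = Inr (m, b)" "v = Inl (x, y)"
      by (metis prod.exhaust sum.exhaust)
    then show ?thesis
    proof cases
      case 1
      obtain m b where s: "s = Inr (m, b)" "y = m * x + b" "y' = m * x' + b"
        using point E(1,2) unfolding 1 by blast
      obtain m' b' where t: "t = Inr (m', b')" "y = m' * x + b'" "y' = m' * x' + b'"
        using point E(3,4) unfolding 1 by blast
      \<comment> \<open>Equal abscissae on a common non-vertical line would give equal
        ordinates.\<close>
      have "x \<noteq> x'" using \<open>u \<noteq> v\<close> s unfolding 1 by blast
      then have "m = m'" using *[of m x b m' b' x'] s t by simp
      then show ?thesis using s t by simp
    next
      case 2
      obtain x where s: "s = Inl (x, m * x + b)" "s = Inl (x, m' * x + b')"
        using line E(1,2) unfolding 2 by blast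
      obtain x' where t: "t = Inl (x', m * x' + b)" "t = Inl (x', m' * x' + b')"
        using line E(3,4) unfolding 2 by blast
      have "x = x' \<or> m = m'" using *[of m x b m' b' x'] s t by simp
      moreover have "m \<noteq> m'" using \<open>u \<noteq> v\<close> s unfolding 2 by auto
      ultimately show ?thesis using s t by simp
    qed (use E point line in blast)+
  qed
  have "card (common_neighbors (incidence_graph F) u v) < 2" if "u \<noteq> v" for u v
  proof -
    \<comment> \<open>\<open>F\<close> may be infinite here; an infinite set has \<open>card\<close>
      0, which also meets the bound.\<close>
    have "card (common_neighbors (incidence_graph F) u v) \<le> Suc 0"
      using eq[OF that] by (cases "finite (common_neighbors (incidence_graph F) u v)") (auto simp: card_le_Suc0_iff_eq)
    then show ?thesis by simp
  qed
  then show ?thesis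
    unfolding closed_graph_def by (meson not_le)
qed

section \<open>Blowing up vertices into cliques\<close>

text \<open>The exception \<open>i = 0\<close> keeps \<open>u\<^sub>0\<close> and
  \<open>v\<^sub>0\<close> adjacent; they lie in every clique built over the edge \<open>u v\<close>
  and tie it to that edge.\<close>

definition blowup :: "nat \<Rightarrow> 'a pair_pre_digraph \<Rightarrow> ('a \<times> nat) pair_pre_digraph" where
  "blowup k G = \<lparr>pverts = pverts G \<times> {..k},
     parcs = {((u, i), (v, j)). u \<in> pverts G \<and> v \<in> pverts G \<and> i \<le> k \<and> j \<le> k \<and>
       (u = v \<and> i \<noteq> j \<or> (u, v) \<in> parcs G \<and> (i \<noteq> j \<or> i = 0))}\<rparr>"

lemma pverts_blowup: "pverts (blowup k G) = pverts G \<times> {..k}"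
  by (simp add: blowup_def)

lemma parcs_blowup_iff:
  "((u, i), (v, j)) \<in> parcs (blowup k G) \<longleftrightarrow> u \<in> pverts G \<and> v \<in> pverts G \<and> i \<le> k \<and> j \<le> k \<and>
     (u = v \<and> i \<noteq> j \<or> (u, v) \<in> parcs G \<and> (i \<noteq> j \<or> i = 0))"
  by (simp add: blowup_def)

text \<open>Meant for \<open>S \<subseteq> {1..k}\<close>: index 0 is inserted over the first end
  and lies in the complement over the second, while each positive index occurs over exactly one
  end.\<close>

definition edge_clique :: "nat \<Rightarrow> 'a \<times> 'a \<Rightarrow> nat set \<Rightarrow> ('a \<times> nat) set" where
  "edge_clique k e S = {fst e} \<times> insert 0 S \<union> {snd e} \<times> ({..k} - S)"

context
  fixes G :: "'a pair_pre_digraph"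
  assumes G: "pair_graph G"
begin

interpretation pair_graph G by (rule G)

lemma pair_graph_blowup: "pair_graph (blowup k G)"
proof (rule pair_graphI)
  show "finite (pverts (blowup k G))"
    using pair_finite_verts by (simp add: pverts_blowup)
next
  fix a b assume "(a, b) \<in> parcs (blowup k G)"
  then show "a \<in> pverts (blowup k G) \<and> b \<in> pverts (blowup k G) \<and> a \<noteq> b \<and> (b, a) \<in> parcs (blowup k G)"
    using arcs_symmetric pair_no_loops
    by (cases a; cases b) (fastforce simp: pverts_blowup parcs_blowup_iff)
qed

lemma closed_blowup:
  assumes closed: "closed_graph 2 G" and tf: "triangle_free G" and "2 * k < c" "k + 1 < c"
  shows "closed_graph c (blowup k G)"
  unfolding closed_graph_def
proof (intro ballI impI, rule ccontr, elim conjE)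
  fix a b
  assume ab: "a \<in> pverts (blowup k G)" "b \<in> pverts (blowup k G)" "a \<noteq> b"
    and large: "c \<le> card (common_neighbors (blowup k G) a b)"
    and nadj: "(a, b) \<notin> parcs (blowup k G)"
  obtain u i v j where a: "a = (u, i)" and b: "b = (v, j)" by fastforce
  let ?N = "common_neighbors (blowup k G) a b"
  have uv: "u \<in> pverts G" "v \<in> pverts G" "i \<le> k" "j \<le> k"
    using ab by (auto simp: a b pverts_blowup)
  have "u \<noteq> v"
    using ab nadj uv by (auto simp: a b parcs_blowup_iff)
  show False
  proof (cases "(u, v) \<in> parcs G")
    case True
    then have "i = j"
      using nadj uv by (auto simp: a b parcs_blowup_iff)
    have "i \<noteq> 0"
      using True nadj uv by (auto simp: a b parcs_blowup_iff)
    \<comment> \<open>A removed matching edge: a common neighbor over a third vertex would give a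
      triangle in \<open>G\<close>, and index \<open>i\<close> is excluded over both ends.\<close>
    have "?N \<subseteq> {u, v} \<times> ({..k} - {i})"
    proof
      fix z assume z: "z \<in> ?N"
      obtain w l where wl: "z = (w, l)" by fastforce
      have E: "((u, i), (w, l)) \<in> parcs (blowup k G)" "((v, i), (w, l)) \<in> parcs (blowup k G)"
        using z by (simp_all add: common_neighbors_def a b wl \<open>i = j\<close>)
      have "w = u \<or> w = v"
        using E tf True unfolding parcs_blowup_iff triangle_free_def by blast
      moreover have "l \<noteq> i" "l \<le> k"
        using E(1) \<open>i \<noteq> 0\<close> by (auto simp: parcs_blowup_iff)
      ultimately show "z \<in> {u, v} \<times> ({..k} - {i})" by (auto simp: wl)
    qed
    then have "card ?N \<le> card ({u, v} \<times> ({..k} - {i}))"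
      by (intro card_mono) auto
    also have "\<dots> = 2 * k"
      using \<open>u \<noteq> v\<close> uv by (simp add: card_cartesian_product)
    finally show False using large assms by simp
  next
    case False
    have "(v, u) \<notin> parcs G" using False arcs_symmetric by blast
    \<comment> \<open>A common neighbor over \<open>u\<close> or \<open>v\<close> itself would
      require the edge \<open>u v\<close>.\<close>
    then have "?N \<subseteq> common_neighbors G u v \<times> {..k}"
      using False \<open>u \<noteq> v\<close>
      by (auto simp: a b common_neighbors_def parcs_blowup_iff)
    moreover have "finite (common_neighbors G u v)"
      using pair_finite_verts by (simp add: common_neighbors_def)
    ultimately have "card ?N \<le> card (common_neighbors G u v) * (k + 1)"
      by (metis card_mono card_cartesian_product card_atMost finite_SigmaI finite_atMost Suc_eq_plus1)
    also have "card (common_neighbors G u v) \<le> 1"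
      using closed False \<open>u \<noteq> v\<close> uv unfolding closed_graph_def by force
    then have "card (common_neighbors G u v) * (k + 1) \<le> 1 * (k + 1)"
      by (rule mult_le_mono1)
    finally show False using large assms by simp
  qed
qed

text \<open>A vertex adjacent to \<open>u\<^sub>0\<close> and \<open>v\<^sub>0\<close> lies over
  \<open>u\<close> or \<open>v\<close>, since \<open>G\<close> has no triangle. If it is missing
  from the clique, its index is positive and its matching partner, to which it is not adjacent, is
  in the clique.\<close>

lemma maximal_clique_edge_clique:
  assumes tf: "triangle_free G" and uv: "(u, v) \<in> parcs G" and S: "S \<subseteq> {1..k}"
  shows "maximal_clique (blowup k G) (edge_clique k (u, v) S)"
proof -
  let ?K = "edge_clique k (u, v) S"
  have vu: "(v, u) \<in> parcs G" using uv arcs_symmetric by blast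
  have V: "u \<in> pverts G" "v \<in> pverts G" using uv wellformed' by auto
  have "u \<noteq> v" using pair_no_loops uv by fastforce
  have S0: "0 \<notin> S" and Sk: "\<And>i. i \<in> S \<Longrightarrow> i \<le> k" using S by auto
  have K0: "(u, 0) \<in> ?K" "(v, 0) \<in> ?K" using S0 by (auto simp: edge_clique_def)
  have "clique (blowup k G) ?K"
    unfolding clique_def using Sk V uv vu
    by (auto simp: edge_clique_def pverts_blowup parcs_blowup_iff)
  moreover have "z \<in> ?K" if K': "clique (blowup k G) K'" "?K \<subseteq> K'" "z \<in> K'" for K' z
  proof (rule ccontr)
    assume "z \<notin> ?K"
    obtain w i where z: "z = (w, i)" by fastforce
    have adj: "(y, z) \<in> parcs (blowup k G)" if "y \<in> ?K" for y
    proof -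
      have "y \<in> K'" "y \<noteq> z" using K'(2) that \<open>z \<notin> ?K\<close> by blast+
      then show ?thesis using K'(1,3) by (simp add: clique_def)
    qed
    have "w = u \<or> w = v"
      using adj[OF K0(1)] adj[OF K0(2)] tf uv
      unfolding z parcs_blowup_iff triangle_free_def by blast
    moreover have "i \<le> k"
      using adj[OF K0(1)] by (auto simp: z parcs_blowup_iff)
    ultimately consider "w = u" "i \<notin> S" "i \<noteq> 0" | "w = v" "i \<in> S" "i \<noteq> 0"
      using \<open>z \<notin> ?K\<close> S0 by (auto simp: z edge_clique_def)
    then show False
    proof cases
      case 1
      then have "(v, i) \<in> ?K" using \<open>i \<le> k\<close> by (simp add: edge_clique_def)
      from adj[OF this] show False using 1 \<open>u \<noteq> v\<close> by (simp add: z parcs_blowup_iff)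
    next
      case 2
      then have "(u, i) \<in> ?K" by (simp add: edge_clique_def)
      from adj[OF this] show False using 2 \<open>u \<noteq> v\<close> by (simp add: z parcs_blowup_iff)
    qed
  qed
  ultimately show ?thesis
    unfolding maximal_clique_def by blast
qed

lemma finite_maximal_cliques: "finite {K. maximal_clique G K}"
  by (rule finite_subset[of _ "Pow (pverts G)"])
    (auto simp: maximal_clique_def clique_def pair_finite_verts)

end

text \<open>Of the two arcs of an edge, \<open>A\<close> may contain only one, since reversing an arc and complementing
  the index set yields the same clique.\<close>

lemma card_maximal_cliques_blowup:
  assumes G: "pair_graph G" and tf: "triangle_free G"
    and A: "A \<subseteq> parcs G" "\<And>u v. (u, v) \<in> A \<Longrightarrow> (v, u) \<notin> A"
  shows "card A * 2 ^ k \<le> card {K. maximal_clique (blowup k G) K}"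
proof -
  let ?D = "A \<times> Pow {1..k}"
  have "inj_on (\<lambda>(e, S). edge_clique k e S) ?D"
  proof (rule inj_onI)
    fix p p'
    assume "p \<in> ?D" "p' \<in> ?D" and "(\<lambda>(e, S). edge_clique k e S) p = (\<lambda>(e, S). edge_clique k e S) p'"
    moreover obtain u v S u' v' S' where p: "p = ((u, v), S)" "p' = ((u', v'), S')"
      by (metis surj_pair)
    ultimately have *: "(u, v) \<in> A" "(u', v') \<in> A" "S \<subseteq> {1..k}" "S' \<subseteq> {1..k}"
      and eq: "edge_clique k (u, v) S = edge_clique k (u', v') S'"
      by auto
    have "u \<noteq> v"
      using A(2)[of u u] *(1) by blast
    \<comment> \<open>Index 0 occurs over both ends, so projection recovers the unordered edge;
      \<open>A\<close> then fixes its orientation.\<close>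
    have fst: "fst ` edge_clique k (x, y) T = {x, y}" if "T \<subseteq> {1..k}" for x y :: 'a and T
    proof -
      have "0 \<in> {..k} - T" using that by auto
      then show ?thesis by (auto simp: edge_clique_def image_Un)
    qed
    have "{u, v} = {u', v'}"
      using fst[OF *(3), of u v] fst[OF *(4), of u' v'] eq by simp
    then have uv: "u = u'" "v = v'"
      using A(2)[OF *(1)] *(2) by (auto simp: doubleton_eq_iff)
    \<comment> \<open>The index set is read off over the first end, dropping the inserted 0.\<close>
    have "T = {i. (u, i) \<in> edge_clique k (u, v) T} - {0}" if "T \<subseteq> {1..k}" for T
      using that \<open>u \<noteq> v\<close> by (auto simp: edge_clique_def)
    from this[OF *(3)] this[OF *(4)] have "S = S'"
      using eq uv by simp
    with uv show "p = p'" by (simp add: p)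
  qed
  then have "card ?D = card ((\<lambda>(e, S). edge_clique k e S) ` ?D)"
    by (simp add: card_image)
  also have "\<dots> \<le> card {K. maximal_clique (blowup k G) K}"
    using finite_maximal_cliques[OF pair_graph_blowup[OF G]] maximal_clique_edge_clique[OF G tf] A(1)
    by (intro card_mono) auto
  finally show ?thesis
    by (simp add: card_cartesian_product card_Pow)
qed

section \<open>Padding with isolated vertices\<close>

text \<open>Positivity of \<open>c\<close> lets isolated vertices stay nonadjacent. Nonemptiness
  rules out the empty maximal clique, which any added vertex would enlarge.\<close>

lemma closed_graph_pad_nat:
  fixes H :: "'a pair_pre_digraph"
  assumes H: "pair_graph H" and closed: "closed_graph c H" and "c > 0"
    and nonempty: "pverts H \<noteq> {}" and card_le: "card (pverts H) \<le> n"
  obtains G :: "nat pair_pre_digraph"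
  where "pair_graph G" "card (pverts G) = n" "closed_graph c G"
    "card {K. maximal_clique H K} \<le> card {K. maximal_clique G K}"
proof -
  interpret H: pair_graph H by fact
  obtain f :: "'a \<Rightarrow> nat" where f: "inj_on f (pverts H)" "f ` pverts H \<subseteq> {..<n}"
    using card_le_inj[of "pverts H" "{..<n}"] H.pair_finite_verts card_le by auto
  define G where "G = \<lparr>pverts = {..<n}, parcs = map_prod f f ` parcs H\<rparr>"
  have V: "pverts G = {..<n}" by (simp add: G_def)
  have E: "(f u, f v) \<in> parcs G \<longleftrightarrow> (u, v) \<in> parcs H" if "u \<in> pverts H" "v \<in> pverts H" for u v
  proof
    assume "(f u, f v) \<in> parcs G"
    then obtain u' v' where "(u', v') \<in> parcs H" "f u' = f u" "f v' = f v"
      by (auto simp: G_def)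
    then show "(u, v) \<in> parcs H"
      using that f(1) H.wellformed'[of u' v'] by (simp add: inj_on_eq_iff)
  qed (auto simp: G_def)
  have ED: "\<exists>u v. a = f u \<and> b = f v \<and> (u, v) \<in> parcs H \<and> u \<in> pverts H \<and> v \<in> pverts H"
    if "(a, b) \<in> parcs G" for a b
    using that by (auto simp: G_def dest: H.wellformed')
  have "pair_graph G"
  proof (rule pair_graphI)
    fix a b assume "(a, b) \<in> parcs G"
    then obtain u v where uv: "a = f u" "b = f v" "(u, v) \<in> parcs H" "u \<in> pverts H" "v \<in> pverts H"
      using ED by blast
    have "u \<noteq> v" using H.pair_no_loops uv(3) by fastforce
    then have "a \<noteq> b" using f(1) uv by (simp add: inj_on_eq_iff)
    moreover have "(b, a) \<in> parcs G"
      using uv H.arcs_symmetric by (simp add: E)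
    ultimately show "a \<in> pverts G \<and> b \<in> pverts G \<and> a \<noteq> b \<and> (b, a) \<in> parcs G"
      using f(2) uv by (auto simp: V)
  qed (simp add: V)
  moreover have "closed_graph c G"
    unfolding closed_graph_def
  proof (intro ballI impI, elim conjE)
    fix a b assume "a \<noteq> b" and large: "c \<le> card (common_neighbors G a b)"
    \<comment> \<open>Having a common neighbor, \<open>a\<close> and \<open>b\<close> are not
      isolated, hence come from \<open>H\<close>.\<close>
    then have "common_neighbors G a b \<noteq> {}" using \<open>c > 0\<close> by auto
    then obtain z where "(a, z) \<in> parcs G" "(b, z) \<in> parcs G"
      by (auto simp: common_neighbors_def)
    then obtain u v where uv: "a = f u" "b = f v" "u \<in> pverts H" "v \<in> pverts H"
      using ED by meson
    have "common_neighbors G a b \<subseteq> f ` common_neighbors H u v"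
    proof
      fix z assume z: "z \<in> common_neighbors G a b"
      then obtain w where "z = f w" "w \<in> pverts H"
        using ED by (fastforce simp: common_neighbors_def)
      with z uv show "z \<in> f ` common_neighbors H u v"
        by (auto simp: common_neighbors_def E)
    qed
    moreover have "finite (common_neighbors H u v)"
      using H.pair_finite_verts by (simp add: common_neighbors_def)
    ultimately have "card (common_neighbors G a b) \<le> card (common_neighbors H u v)"
      by (rule surj_card_le[rotated])
    then have "c \<le> card (common_neighbors H u v)" using large by simp
    then show "(a, b) \<in> parcs G"
      using closed \<open>a \<noteq> b\<close> uv by (auto simp: closed_graph_def E)
  qed
  moreover have "card {K. maximal_clique H K} \<le> card {K. maximal_clique G K}"
  proof (rule card_inj_on_le[where f = "image f"])
    show "inj_on ((`) f) {K. maximal_clique H K}"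
      using inj_on_image_Pow[OF f(1)]
      by (rule inj_on_subset) (auto simp: maximal_clique_def clique_def)
    show "finite {K. maximal_clique G K}"
      by (rule finite_maximal_cliques) fact
    have "maximal_clique G (f ` K)" if K: "maximal_clique H K" for K
    proof -
      have KV: "K \<subseteq> pverts H" and cl: "clique H K"
        using K by (auto simp: maximal_clique_def clique_def)
      obtain x where "x \<in> pverts H" using nonempty by blast
      then have "clique H {x}" by (simp add: clique_def)
      then have "K \<noteq> {}" using K unfolding maximal_clique_def by blast
      have "clique G (f ` K)"
        using cl f unfolding clique_def by (auto simp: V E subset_iff)
      moreover have False if K': "clique G K'" "f ` K \<subset> K'" for K'
      proof -
        \<comment> \<open>With two distinct elements in the clique \<open>K'\<close>, each of its
          vertices has a neighbor, so none is a padding vertex and \<open>K'\<close> pulls back to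
          \<open>H\<close>.\<close>
        obtain a b where ab: "a \<in> K'" "b \<in> K'" "a \<noteq> b"
          using \<open>K \<noteq> {}\<close> K'(2) by blast
        have sub: "K' \<subseteq> f ` pverts H"
        proof
          fix y assume "y \<in> K'"
          then obtain y' where "(y, y') \<in> parcs G"
            using ab K'(1) unfolding clique_def by metis
          then show "y \<in> f ` pverts H" using ED by blast
        qed
        define L where "L = {v \<in> pverts H. f v \<in> K'}"
        have "K' = f ` L" using sub by (auto simp: L_def)
        have "clique H L"
          unfolding clique_def
        proof (intro conjI ballI impI)
          fix u v assume uv: "u \<in> L" "v \<in> L" "u \<noteq> v"
          then have "f u \<noteq> f v" using f(1) by (simp add: L_def inj_on_eq_iff)
          then show "(u, v) \<in> parcs H"
            using uv K'(1) by (simp add: L_def clique_def flip: E)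
        qed (auto simp: L_def)
        moreover have "K \<subseteq> L" using K'(2) KV by (auto simp: L_def)
        moreover have "K \<noteq> L" using K'(2) \<open>K' = f ` L\<close> by auto
        ultimately show False using K unfolding maximal_clique_def by blast
      qed
      ultimately show ?thesis unfolding maximal_clique_def by blast
    qed
    then show "(`) f ` {K. maximal_clique H K} \<subseteq> {K. maximal_clique G K}" by blast
  qed
  ultimately show thesis using that V by simp
qed

section \<open>Counting\<close>

lemma exists_closed_graph_many_maximal_cliques:
  fixes r k c n :: nat
  assumes "r > 0" "2 * k < c" "k + 1 < c" and n: "2 * (k + 1) * (2 ^ r)\<^sup>2 \<le> n"
  shows "\<exists>G :: nat pair_pre_digraph. pair_graph G \<and> card (pverts G) = n \<and> closed_graph c G \<and>
    (2 ^ r) ^ 3 * 2 ^ k \<le> card {K. maximal_clique G K}"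
proof -
  obtain F :: "bit alg_closure set" where F: "card F = 2 ^ r"
    "\<And>x y. x \<in> F \<Longrightarrow> y \<in> F \<Longrightarrow> x + y \<in> F" "\<And>x y. x \<in> F \<Longrightarrow> y \<in> F \<Longrightarrow> x * y \<in> F"
    using finite_field_power_2_exists[OF \<open>r > 0\<close>] by blast
  \<comment> \<open>An infinite set would have \<open>card\<close> 0.\<close>
  have "finite F" using F(1) by (metis card.infinite power_not_zero zero_neq_numeral)
  let ?B = "incidence_graph F"
  have B: "pair_graph ?B"
    using \<open>finite F\<close> F(2,3) by (rule pair_graph_incidence_graph)
  have card: "card (pverts (blowup k ?B)) = 2 * (k + 1) * (2 ^ r)\<^sup>2"
    using \<open>finite F\<close>
    by (simp add: pverts_blowup card_cartesian_product card_pverts_incidence_graph F(1) mult_ac)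
  have "pverts (blowup k ?B) \<noteq> {}"
  proof
    assume "pverts (blowup k ?B) = {}"
    with card show False by simp
  qed
  then obtain G :: "nat pair_pre_digraph" where G: "pair_graph G" "card (pverts G) = n" "closed_graph c G"
    "card {K. maximal_clique (blowup k ?B) K} \<le> card {K. maximal_clique G K}"
    using closed_graph_pad_nat[of "blowup k ?B" c n] pair_graph_blowup[OF B]
      closed_blowup[OF B closed_incidence_graph triangle_free_incidence_graph] assms card
    by (metis zero_less_iff_neq_zero not_less_zero)
  have "card (flags F) * 2 ^ k \<le> card {K. maximal_clique (blowup k ?B) K}"
    using B triangle_free_incidence_graph flags_subset_parcs flags_asym
    by (rule card_maximal_cliques_blowup)
  with G show ?thesis by (auto simp: card_flags F(1) intro: order_trans)
qed

theorem theorem1p4: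
  shows "\<exists>C::real. C > 0 \<and>
    (\<forall>c::nat. c \<ge> 2 \<longrightarrow>
      (\<exists>N::nat. \<forall>n\<ge>N. \<exists>G :: nat pair_pre_digraph.
         pair_graph G \<and> card (pverts G) = n \<and> closed_graph c G \<and>
         real (card {K. maximal_clique G K})
           \<ge> C * real c powr (- 3 / 2) * 2 powr (real c / 2) * real n powr (3 / 2)))"
proof -
  \<comment> \<open>The factor \<open>8 powr (- 3 / 2)\<close> offsets
    \<open>n < 8 * c * q\<^sup>2\<close>; the 2 offsets the rounding in \<open>k\<close>, where
    \<open>2 powr (c / 2)\<close> is at most \<open>2 * 2 ^ k\<close>.\<close>
  define C :: real where "C = 8 powr (- 3 / 2) / 2"
  have "\<exists>G :: nat pair_pre_digraph.
         pair_graph G \<and> card (pverts G) = n \<and> closed_graph c G \<and>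
         real (card {K. maximal_clique G K})
           \<ge> C * real c powr (- 3 / 2) * 2 powr (real c / 2) * real n powr (3 / 2)"
    if c: "c \<ge> 2" and n: "n \<ge> 8 * c" for c n :: nat
  proof -
    \<comment> \<open>The largest \<open>k\<close> with \<open>2 * k < c\<close>.\<close>
    define k where "k = (c - 1) div 2"
    have k: "2 * k < c" "k + 1 < c" "c \<le> 2 * (k + 1)"
      using c unfolding k_def by presburger+
    \<comment> \<open>The threshold \<open>8 * c\<close> is chosen for this bound, which makes
      \<open>r\<close> positive.\<close>
    have "4 \<le> n div (2 * c)"
      using c n by (simp add: less_eq_div_iff_mult_less_eq)
    \<comment> \<open>\<open>4 ^ r\<close> is the square of the field size \<open>q\<close>;
      consecutive powers of 4 determine \<open>n / c\<close> up to a constant factor.\<close>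
    then obtain r where r: "4 ^ r \<le> n div (2 * c)" "n div (2 * c) < 4 ^ (r + 1)"
      using ex_power_ivl1[of 4 "n div (2 * c)"] by auto
    have "r > 0"
      using r(2) \<open>4 \<le> n div (2 * c)\<close> by (cases r) auto
    define q :: nat where "q = 2 ^ r"
    have q2: "q\<^sup>2 = 4 ^ r" by (simp add: q_def power2_eq_square flip: power_mult_distrib)
    have lower: "2 * c * q\<^sup>2 \<le> n"
      using r(1) c by (simp add: q2 less_eq_div_iff_mult_less_eq mult_ac)
    have upper: "n < 8 * c * q\<^sup>2"
      using r(2) c by (simp add: q2 div_less_iff_less_mult mult_ac)
    \<comment> \<open>The vertex count of the blow-up fits, as \<open>k + 1 < c\<close>.\<close>
    have "2 * (k + 1) * q\<^sup>2 \<le> n"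
      using lower k(2) by (meson le_trans less_imp_le mult_le_mono1 mult_le_mono2)
    then obtain G :: "nat pair_pre_digraph" where G: "pair_graph G" "card (pverts G) = n"
      "closed_graph c G" and many: "q ^ 3 * 2 ^ k \<le> card {K. maximal_clique G K}"
      using exists_closed_graph_many_maximal_cliques[OF \<open>r > 0\<close> k(1,2)] unfolding q_def by blast
    have "real n \<le> 8 * real c * real q ^ 2"
      using of_nat_mono[OF less_imp_le[OF upper], where 'a = real] by simp
    then have "real n powr (3 / 2) \<le> (8 * real c * real q ^ 2) powr (3 / 2)"
      by (intro powr_mono2) simp_all
    also have "\<dots> = 8 powr (3 / 2) * real c powr (3 / 2) * real q ^ 3"
      by (simp add: powr_mult powr_powr q_def mult.commute flip: powr_realpow)
    finally have n_le: "real n powr (3 / 2) \<le> 8 powr (3 / 2) * real c powr (3 / 2) * real q ^ 3" .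
    have "2 powr (real c / 2) \<le> (2 :: real) powr real (k + 1)"
      using of_nat_mono[OF k(3), where 'a = real] by (intro powr_mono) simp_all
    also have "\<dots> = 2 * 2 ^ k"
      by (subst powr_realpow) simp_all
    finally have c_le: "2 powr (real c / 2) \<le> (2 * 2 ^ k :: real)" .
    have "C * real c powr (- 3 / 2) * 2 powr (real c / 2) * real n powr (3 / 2)
        \<le> C * real c powr (- 3 / 2) * (2 * 2 ^ k) * (8 powr (3 / 2) * real c powr (3 / 2) * real q ^ 3)"
      using n_le c_le by (intro mult_mono) (simp_all add: C_def)
    also have "\<dots> = real q ^ 3 * 2 ^ k"
      using c by (simp add: C_def powr_minus field_simps)
    also have "\<dots> \<le> real (card {K. maximal_clique G K})"
      using of_nat_mono[OF many, where 'a = real] by simp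
    finally show ?thesis using G by blast
  qed
  moreover have "C > 0" by (simp add: C_def)
  ultimately show ?thesis by blast
qed

end
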